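(* Any CNF or DNF on $n$ variables with $m$ clauses has an NN representation with $m+1$ anchors and constant bit-complexity.
   Context: Let $\Delta(\mathbf{x},\mathbf{y})=\|\mathbf{x}-\mathbf{y}\|_2^2$. An NN representation of $f:\{0,1\}^n\to\{0,1\}$ is a pair of disjoint finite sets $P,N\subseteq\mathbb{R}^n$ (anchors) such that $f(\mathbf{x})=1$ if some $\mathbf{p}\in P$ has $\Delta(\mathbf{x},\mathbf{p})<\Delta(\mathbf{x},\mathbf{q})$ for all $\mathbf{q}\in N$, and $f(\mathbf{x})=0$ if some $\mathbf{q}\in N$ has $\Delta(\mathbf{x},\mathbf{q})<\Delta(\mathbf{x},\mathbf{p})$ for all $\mathbf{p}\in P$. Constant bit-complexity means every coordinate of every anchor is a rational number whose binary description uses a number of bits bounded by an absolute constant (independent of $n$ and $m$). A CNF is an AND of clauses, each an OR of literals; a DNF is an OR of clauses (terms), each an AND of literals. *)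

theory Defs
  imports
    Complex_Main
    "HOL-Library.Log_Nat"
    "Jordan_Normal_Form.Matrix"
begin

section \<open>CNF and DNF formulas\<close>

text \<open>Variables are indexed from 0. A clause is a set of literals, and a formula is a set of
  clauses, so the number of clauses of \<open>\<Phi>\<close> is \<open>card \<Phi>\<close>. The same data is read
  either as a CNF or as a DNF. Empty formulas, empty clauses, and clauses containing both a
  variable and its negation are allowed.\<close>

datatype literal = Pos (var: nat) | Neg (var: nat)

type_synonym clause = "literal set"

definition formula_on :: "nat \<Rightarrow> clause set \<Rightarrow> bool" where
  "formula_on n \<Phi> \<longleftrightarrow> finite \<Phi> \<and> (\<forall>C\<in>\<Phi>. finite C \<and> (\<forall>l\<in>C. var l < n))"

text \<open>Inputs are the vertices of the hypercube in real \<open>n\<close>-space, so that their distances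
  to anchors make sense; the values 0 and 1 of a Boolean function are
  \<^const>\<open>False\<close> and \<^const>\<open>True\<close>.\<close>

definition hypercube :: "nat \<Rightarrow> real vec set" where
  "hypercube n = {x \<in> carrier_vec n. \<forall>i<n. x $ i \<in> {0, 1}}"

fun eval_literal :: "real vec \<Rightarrow> literal \<Rightarrow> bool" where
  "eval_literal x (Pos i) \<longleftrightarrow> x $ i = 1"
| "eval_literal x (Neg i) \<longleftrightarrow> x $ i = 0"

definition eval_cnf :: "clause set \<Rightarrow> real vec \<Rightarrow> bool" where
  "eval_cnf \<Phi> x \<longleftrightarrow> (\<forall>C\<in>\<Phi>. \<exists>l\<in>C. eval_literal x l)"

definition eval_dnf :: "clause set \<Rightarrow> real vec \<Rightarrow> bool" where
  "eval_dnf \<Phi> x \<longleftrightarrow> (\<exists>C\<in>\<Phi>. \<forall>l\<in>C. eval_literal x l)"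

section \<open>Nearest neighbor representations\<close>

definition sq_dist :: "real vec \<Rightarrow> real vec \<Rightarrow> real" where
  "sq_dist x y = (x - y) \<bullet> (x - y)"

text \<open>The equivalences rule out ties: on every input the nearest anchor is of a
  well-defined kind, and it determines the value of \<open>f\<close>. One of the two anchor sets may
  be empty.\<close>

definition nn_representation ::
  "nat \<Rightarrow> (real vec \<Rightarrow> bool) \<Rightarrow> real vec set \<Rightarrow> real vec set \<Rightarrow> bool" where
  "nn_representation n f P N \<longleftrightarrow>
     finite P \<and> finite N \<and> P \<subseteq> carrier_vec n \<and> N \<subseteq> carrier_vec n \<and> P \<inter> N = {} \<and>
     (\<forall>x\<in>hypercube n.
        (f x \<longleftrightarrow> (\<exists>p\<in>P. \<forall>q\<in>N. sq_dist x p < sq_dist x q)) \<and>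
        (\<not> f x \<longleftrightarrow> (\<exists>q\<in>N. \<forall>p\<in>P. sq_dist x q < sq_dist x p)))"

text \<open>A rational number is written as a sign bit followed by the binary expansions of the
  numerator and denominator of its reduced fraction.\<close>

definition rat_bits :: "rat \<Rightarrow> int" where
  "rat_bits r = 1 + bitlen \<bar>fst (quotient_of r)\<bar> + bitlen (snd (quotient_of r))"

definition bit_complexity_le :: "int \<Rightarrow> real vec set \<Rightarrow> bool" where
  "bit_complexity_le B A \<longleftrightarrow>
     (\<forall>a\<in>A. \<forall>i<dim_vec a. \<exists>r. a $ i = of_rat r \<and> rat_bits r \<le> B)"

end

theory Submission
  imports Defs
begin

text \<open>
  For a DNF, take the centre of the cube as the only negative anchor: it is equidistant from all
  inputs. A term gets the positive anchor whose displacement from the centre is \<open>1\<close> or \<open>-1\<close> in the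
  coordinate of each of its literals. A satisfied literal then contributes nothing to the
  difference of squared distances and a violated one contributes 2, so a satisfied term would
  tie with the centre; shortening the displacement of a single literal to one half breaks these
  ties and stays below the cost of a violation. A coordinate occurring with both signs is displaced
  by 2, which pushes the anchor too far away from every input while keeping anchors of different
  terms different. The empty term lies at the centre itself, but then the formula is a tautology and
  every anchor can be positive. CNFs follow by De Morgan, exchanging the two anchor sets.
\<close>

definition centered_point :: "nat \<Rightarrow> (nat \<Rightarrow> real) \<Rightarrow> real vec" where
  "centered_point n t = vec n (\<lambda>i. 1/2 + t i)"

text \<open>Expand the square; the cross term is \<open>-2 * (x $ i - 1/2) * t i\<close>. Since
  \<open>2 * x $ i - 1\<close> is 1 or -1, an offset of size \<open>a\<close> costs
  \<open>a^2 - a\<close> if its sign agrees with the input and \<open>a^2 + a\<close> if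
  not.\<close>

lemma sq_dist_centered_point:
  assumes "x \<in> hypercube n"
  shows "sq_dist x (centered_point n t) =
    sq_dist x (centered_point n (\<lambda>_. 0)) + (\<Sum>i<n. (t i)\<^sup>2 - (2 * x $ i - 1) * t i)"
proof -
  have dim: "dim_vec x = n"
    using assms by (auto simp: hypercube_def)
  show ?thesis
    by (simp add: sq_dist_def centered_point_def scalar_prod_def dim atLeast0LessThan
        sum.distrib[symmetric] power2_eq_square algebra_simps)
qed

definition pivot :: "clause \<Rightarrow> nat" where
  "pivot C = (SOME i. i \<in> var ` C)"

definition term_offset :: "clause \<Rightarrow> nat \<Rightarrow> real" where
  "term_offset C i =
    (if Pos i \<in> C \<and> Neg i \<in> C then 2
     else if Pos i \<in> C then (if i = pivot C then 1/2 else 1)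
     else if Neg i \<in> C then (if i = pivot C then -1/2 else -1)
     else 0)"

definition term_anchor :: "nat \<Rightarrow> clause \<Rightarrow> real vec" where
  "term_anchor n C = centered_point n (term_offset C)"

definition cube_center :: "nat \<Rightarrow> real vec" where
  "cube_center n = centered_point n (\<lambda>_. 0)"

lemma pivot_in_vars: "C \<noteq> {} \<Longrightarrow> pivot C \<in> var ` C"
  unfolding pivot_def by (rule someI_ex) auto

text \<open>The four cases take values in the disjoint sets {2}, {1/2, 1}, {-1/2, -1} and {0}, so a
  value reveals the literals even when the pivots of \<open>C\<close> and \<open>D\<close>
  differ.\<close>

lemma term_offset_eq_iff:
  assumes "term_offset C i = term_offset D i"
  shows "Pos i \<in> C \<longleftrightarrow> Pos i \<in> D" and "Neg i \<in> C \<longleftrightarrow> Neg i \<in> D"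
  using assms by (auto simp: term_offset_def split: if_splits)

text \<open>Needed for the exact number of anchors. A vector of dimension \<open>n\<close> records
  only variables below \<open>n\<close>, hence the restriction.\<close>

lemma inj_on_term_anchor: "inj_on (term_anchor n) {C. \<forall>l\<in>C. var l < n}"
proof (rule inj_onI)
  fix C D
  assume C: "C \<in> {C. \<forall>l\<in>C. var l < n}" and D: "D \<in> {C. \<forall>l\<in>C. var l < n}"
    and eq: "term_anchor n C = term_anchor n D"
  have "l \<in> C \<longleftrightarrow> l \<in> D" for l
  proof (cases "var l < n")
    case True
    with eq have "term_offset C (var l) = term_offset D (var l)"
      by (auto simp: term_anchor_def centered_point_def vec_eq_iff)
    from term_offset_eq_iff[OF this] show ?thesis
      by (cases l) auto
  next
    case False
    with C D show ?thesis by auto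
  qed
  then show "C = D" by blast
qed

lemma term_anchor_empty: "term_anchor n {} = cube_center n"
  by (simp add: term_anchor_def cube_center_def term_offset_def[abs_def])

text \<open>The total cost is -1/4 for a satisfied term and at least 3/4 otherwise, so the anchor
  never ties with the centre.\<close>

lemma term_anchor_cost:
  assumes x: "x \<in> hypercube n" and vars: "\<forall>l\<in>C. var l < n" and ne: "C \<noteq> {}"
  shows "sq_dist x (term_anchor n C) < sq_dist x (cube_center n) \<longleftrightarrow> (\<forall>l\<in>C. eval_literal x l)"
    and "sq_dist x (cube_center n) < sq_dist x (term_anchor n C) \<longleftrightarrow> \<not> (\<forall>l\<in>C. eval_literal x l)"
proof -
  define g where "g i = (term_offset C i)\<^sup>2 - (2 * x $ i - 1) * term_offset C i" for i
  \<comment> \<open>\<open>b\<close> is the cost profile of a satisfied term: offsets 0 and 1 cost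
    nothing, the shortened one costs 1/4 - 1/2.\<close>
  define b where "b i = (if i = pivot C then -1/4 else 0 :: real)" for i
  have diff: "sq_dist x (term_anchor n C) = sq_dist x (cube_center n) + (\<Sum>i<n. g i)"
    unfolding term_anchor_def cube_center_def g_def by (rule sq_dist_centered_point[OF x])
  have bit: "x $ i = 0 \<or> x $ i = 1" if "i < n" for i
    using x that by (auto simp: hypercube_def)
  have "pivot C < n"
    using pivot_in_vars[OF ne] vars by auto
  then have sum_b: "(\<Sum>i<n. b i) = -1/4"
    by (simp add: b_def)
  have pivot_lit: "Pos (pivot C) \<in> C \<or> Neg (pivot C) \<in> C"
    using pivot_in_vars[OF ne] by (metis imageE literal.exhaust_sel)
  have sat: "(\<Sum>i<n. g i) < 0" if all: "\<forall>l\<in>C. eval_literal x l"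
  proof -
    have "x $ i = 1" if "Pos i \<in> C" for i
      using all that by force
    moreover have "x $ i = 0" if "Neg i \<in> C" for i
      using all that by force
    \<comment> \<open>No variable of a satisfied term has both signs, so the offset 2 does not
      occur.\<close>
    ultimately have "g i = b i" for i
      using pivot_lit by (fastforce simp: g_def b_def term_offset_def power2_eq_square)
    then show ?thesis using sum_b by simp
  qed
  have unsat: "(\<Sum>i<n. g i) > 0" if "\<not> (\<forall>l\<in>C. eval_literal x l)"
  proof -
    from that obtain l where l: "l \<in> C" "\<not> eval_literal x l" by auto
    define j where "j = var l"
    have j: "j < n" using l vars by (simp add: j_def)
    \<comment> \<open>A violated literal raises the cost by exactly 1 at a shortened offset (from
      -1/4 to 3/4) and by at least 2 elsewhere.\<close>
    have "b i + (if i = j then 1 else 0) \<le> g i" if "i < n" for i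
      using bit[OF that] l
      by (cases l) (auto simp: g_def b_def j_def term_offset_def power2_eq_square)
    then have "(\<Sum>i<n. b i + (if i = j then 1 else 0)) \<le> (\<Sum>i<n. g i)"
      by (intro sum_mono) auto
    then show ?thesis using sum_b j by (simp add: sum.distrib)
  qed
  show "sq_dist x (term_anchor n C) < sq_dist x (cube_center n) \<longleftrightarrow> (\<forall>l\<in>C. eval_literal x l)"
    and "sq_dist x (cube_center n) < sq_dist x (term_anchor n C) \<longleftrightarrow> \<not> (\<forall>l\<in>C. eval_literal x l)"
    using sat unsat diff by (smt (verit))+
qed

text \<open>One half plus each value of \<open>term_offset\<close>, and 3 for the padding anchor of
  formulas with an empty term.\<close>

definition anchor_coords :: "rat set" where
  "anchor_coords = {-1/2, 0, 1/2, 1, 3/2, 5/2, 3}"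

lemma half_plus_term_offset: "1/2 + term_offset C i \<in> of_rat ` anchor_coords"
  by (simp add: term_offset_def anchor_coords_def of_rat_divide of_rat_minus)

text \<open>\<open>B\<close> is fixed before \<open>A\<close>, so it is uniform in the dimension and
  the formula.\<close>

lemma bounded_bit_complexity:
  assumes "finite S"
  shows "\<exists>B. \<forall>A. (\<forall>a\<in>A. \<forall>i<dim_vec a. a $ i \<in> of_rat ` S) \<longrightarrow> bit_complexity_le B A"
proof (intro exI allI impI)
  fix A :: "real vec set"
  assume A: "\<forall>a\<in>A. \<forall>i<dim_vec a. a $ i \<in> of_rat ` S"
  have "rat_bits r \<le> Max (rat_bits ` S)" if "r \<in> S" for r
    using assms that by simp
  with A show "bit_complexity_le (Max (rat_bits ` S)) A"
    unfolding bit_complexity_le_def by blast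
qed

lemma dnf_nn_representation:
  assumes n: "0 < n" and \<Phi>: "formula_on n \<Phi>"
  shows "\<exists>P N. nn_representation n (eval_dnf \<Phi>) P N \<and> card (P \<union> N) = card \<Phi> + 1 \<and>
    (\<forall>a\<in>P \<union> N. \<forall>i<dim_vec a. a $ i \<in> of_rat ` anchor_coords)"
proof -
  define P where "P = term_anchor n ` \<Phi>"
  have fin: "finite P" and vars: "\<And>C. C \<in> \<Phi> \<Longrightarrow> \<forall>l\<in>C. var l < n"
    using \<Phi> by (auto simp: formula_on_def P_def)
  have inj: "inj_on (term_anchor n) \<Phi>"
    by (rule inj_on_subset[OF inj_on_term_anchor]) (use vars in auto)
  then have card_P: "card P = card \<Phi>"
    by (simp add: P_def card_image)
  have carrier: "P \<subseteq> carrier_vec n"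
    by (auto simp: P_def term_anchor_def centered_point_def)
  have coords: "\<forall>a\<in>P. \<forall>i<dim_vec a. a $ i \<in> of_rat ` anchor_coords"
    using half_plus_term_offset
    by (auto simp: P_def term_anchor_def centered_point_def simp del: of_rat_add)
  show ?thesis
  proof (cases "{} \<in> \<Phi>")
    case True
    \<comment> \<open>A further positive anchor pads the count. No term has offset 5/2, so
      coordinate 0, present as \<open>0 < n\<close>, tells it from \<open>P\<close>.\<close>
    define z where "z = centered_point n (\<lambda>_. 5/2)"
    have "term_anchor n C \<noteq> z" for C
    proof
      assume "term_anchor n C = z"
      then have "term_offset C 0 = 5/2"
        using n by (auto simp: term_anchor_def z_def centered_point_def vec_eq_iff)
      then show False by (simp add: term_offset_def split: if_splits)
    qed
    then have "z \<notin> P" by (auto simp: P_def)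
    moreover have "eval_dnf \<Phi> x" for x
      using True by (auto simp: eval_dnf_def)
    moreover have "\<forall>i<dim_vec z. z $ i \<in> of_rat ` anchor_coords"
      by (simp add: z_def centered_point_def anchor_coords_def)
    moreover have "z \<in> carrier_vec n"
      by (simp add: z_def centered_point_def)
    ultimately have "nn_representation n (eval_dnf \<Phi>) (insert z P) {} \<and>
      card (insert z P \<union> {}) = card \<Phi> + 1 \<and>
      (\<forall>a\<in>insert z P \<union> {}. \<forall>i<dim_vec a. a $ i \<in> of_rat ` anchor_coords)"
      using fin card_P carrier coords by (auto simp: nn_representation_def)
    then show ?thesis by blast
  next
    case False
    have "cube_center n \<notin> P"
    proof
      assume "cube_center n \<in> P"
      \<comment> \<open>The centre is the anchor of the empty term, so injectivity applies.\<close>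
      then obtain C where C: "C \<in> \<Phi>" "term_anchor n C = term_anchor n {}"
        by (auto simp: P_def term_anchor_empty)
      then have "C = {}"
        using vars by (intro inj_onD[OF inj_on_term_anchor]) auto
      with C False show False by simp
    qed
    moreover have "cube_center n \<in> carrier_vec n"
      by (simp add: cube_center_def centered_point_def)
    moreover have "\<forall>i<dim_vec (cube_center n). cube_center n $ i \<in> of_rat ` anchor_coords"
      by (simp add: cube_center_def centered_point_def anchor_coords_def of_rat_divide)
    moreover have "eval_dnf \<Phi> x \<longleftrightarrow> (\<exists>p\<in>P. sq_dist x p < sq_dist x (cube_center n))"
      and "\<not> eval_dnf \<Phi> x \<longleftrightarrow> (\<forall>p\<in>P. sq_dist x (cube_center n) < sq_dist x p)"
      if x: "x \<in> hypercube n" for x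
    proof -
      have "C \<noteq> {}" if "C \<in> \<Phi>" for C
        using that False by auto
      note cost = term_anchor_cost[OF x vars this]
      show "eval_dnf \<Phi> x \<longleftrightarrow> (\<exists>p\<in>P. sq_dist x p < sq_dist x (cube_center n))"
        and "\<not> eval_dnf \<Phi> x \<longleftrightarrow> (\<forall>p\<in>P. sq_dist x (cube_center n) < sq_dist x p)"
        by (simp_all add: eval_dnf_def P_def cost)
    qed
    ultimately have "nn_representation n (eval_dnf \<Phi>) P {cube_center n} \<and>
      card (P \<union> {cube_center n}) = card \<Phi> + 1 \<and>
      (\<forall>a\<in>P \<union> {cube_center n}. \<forall>i<dim_vec a. a $ i \<in> of_rat ` anchor_coords)"
      using fin card_P carrier coords by (simp add: nn_representation_def)
    then show ?thesis by blast
  qed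
qed

fun negate_literal :: "literal \<Rightarrow> literal" where
  "negate_literal (Pos i) = Neg i"
| "negate_literal (Neg i) = Pos i"

lemma negate_literal_involution [simp]: "negate_literal (negate_literal l) = l"
  by (cases l) auto

lemma inj_negate_literal: "inj negate_literal"
  by (metis injI negate_literal_involution)

lemma var_negate_literal [simp]: "var (negate_literal l) = var l"
  by (cases l) auto

text \<open>The tests for 1 and for 0 are complementary only at coordinates of a cube
  vertex.\<close>

lemma eval_negate_literal:
  "x \<in> hypercube n \<Longrightarrow> var l < n \<Longrightarrow> eval_literal x (negate_literal l) \<longleftrightarrow> \<not> eval_literal x l"
  by (cases l) (auto simp: hypercube_def)

lemma eval_cnf_de_morgan:
  assumes "x \<in> hypercube n" "formula_on n \<Phi>"
  shows "eval_cnf \<Phi> x \<longleftrightarrow> \<not> eval_dnf (image negate_literal ` \<Phi>) x"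
  using assms by (auto simp: eval_cnf_def eval_dnf_def formula_on_def eval_negate_literal)

text \<open>The definition is symmetric under exchanging the anchor sets together with the two
  values.\<close>

lemma nn_representation_complement:
  assumes "nn_representation n f P N" and "\<And>x. x \<in> hypercube n \<Longrightarrow> g x \<longleftrightarrow> \<not> f x"
  shows "nn_representation n g N P"
  using assms unfolding nn_representation_def by (simp add: Int_commute) blast

lemma cnf_nn_representation:
  assumes "0 < n" and \<Phi>: "formula_on n \<Phi>"
  shows "\<exists>P N. nn_representation n (eval_cnf \<Phi>) P N \<and> card (P \<union> N) = card \<Phi> + 1 \<and>
    (\<forall>a\<in>P \<union> N. \<forall>i<dim_vec a. a $ i \<in> of_rat ` anchor_coords)"
proof -
  define \<Psi> where "\<Psi> = image negate_literal ` \<Phi>"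
  have \<Psi>: "formula_on n \<Psi>"
    using \<Phi> by (auto simp: formula_on_def \<Psi>_def)
  \<comment> \<open>Negation keeps distinct clauses distinct, so the clause count is
    preserved.\<close>
  have "inj (image negate_literal)"
    using inj_negate_literal by (simp add: inj_image_eq_iff inj_def)
  then have card: "card \<Psi> = card \<Phi>"
    unfolding \<Psi>_def by (intro card_image) (blast intro: inj_on_subset)
  obtain P N where PN: "nn_representation n (eval_dnf \<Psi>) P N" "card (P \<union> N) = card \<Phi> + 1"
    "\<forall>a\<in>P \<union> N. \<forall>i<dim_vec a. a $ i \<in> of_rat ` anchor_coords"
    using dnf_nn_representation[OF assms(1) \<Psi>] card by auto
  have "nn_representation n (eval_cnf \<Phi>) N P"
    using PN(1) by (rule nn_representation_complement) (simp add: eval_cnf_de_morgan \<Phi> \<Psi>_def)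
  with PN show ?thesis
    by (metis Un_commute)
qed

theorem theorem9:
  shows "\<exists>B::int. \<forall>(n::nat) (m::nat) (\<Phi>::clause set).
    0 < n \<and> formula_on n \<Phi> \<and> card \<Phi> = m \<longrightarrow>
      (\<exists>P N. nn_representation n (eval_cnf \<Phi>) P N \<and>
         card (P \<union> N) = m + 1 \<and> bit_complexity_le B (P \<union> N)) \<and>
      (\<exists>P N. nn_representation n (eval_dnf \<Phi>) P N \<and>
         card (P \<union> N) = m + 1 \<and> bit_complexity_le B (P \<union> N))"
proof -
  have "finite anchor_coords"
    by (simp add: anchor_coords_def)
  then obtain B where
    "\<And>A. \<forall>a\<in>A. \<forall>i<dim_vec a. a $ i \<in> of_rat ` anchor_coords \<Longrightarrow> bit_complexity_le B A"
    using bounded_bit_complexity by metis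
  then show ?thesis
    using cnf_nn_representation dnf_nn_representation by metis
qed

end
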